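(* Let $\mathbb{E}_1,\mathbb{E}_2$ be Euclidean spaces, let $\{b_1,\dots,b_n\}\subset\mathbb{E}_2$ and let $f_i:\mathbb{E}_1\to\mathbb{R}$ be convex for all $i=1,\dots,n$. Define $F:\mathbb{E}_1\to\mathbb{E}_2$ by $F(x)=\sum_{i=1}^nf_i(x)b_i$ and let $K:=\mathrm{cone}\{b_1,\dots,b_n\}$. Then the following hold: (a) $F$ is $K$-convex and $K$-closed. (b) $K\subset-K^\circ$ if and only if $\langle b_i,b_j\rangle\ge0$ for all $i,j=1,\dots,n$. (c) Suppose that, for all $i=1,\dots,n$, we have $C_i:=\bigcap_{j\ne i}\mathrm{argmin}\,f_j\ne\emptyset$ and that $f_i$ has no affine majorant on $C_i$. Then $K\text{-}\mathrm{epi}\,F=\overline{\mathrm{conv}}(\mathrm{gph}\,F)$.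
   Context: A Euclidean space is a finite-dimensional real inner product space. $\mathrm{cone}\,S$ is the convex conical hull of $S$; $K^\circ:=\{v : \langle u,v\rangle\le0\ \forall u\in K\}$. $K\text{-}\mathrm{epi}\,F:=\{(x,y)\in\mathbb{E}_1\times\mathbb{E}_2 : y-F(x)\in K\}$; $F$ is $K$-convex (resp. $K$-closed) if this set is convex (resp. closed). $\mathrm{gph}\,F$ is the graph and $\overline{\mathrm{conv}}$ the closed convex hull. $\mathrm{argmin}\,f_j$ is the set of global minimizers of $f_j$ over $\mathbb{E}_1$. An affine majorant of $f_i$ on $C_i$ is an affine function $\phi:\mathbb{E}_1\to\mathbb{R}$ with $f_i(x)\le\phi(x)$ for all $x\in C_i$. *)

theory Defs
  imports "HOL-Analysis.Analysis"
begin

definition polar_cone :: "'a::real_inner set \<Rightarrow> 'a set" where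
  "polar_cone K = {v. \<forall>u\<in>K. u \<bullet> v \<le> 0}"

definition K_epi :: "'b::real_vector set \<Rightarrow> ('a \<Rightarrow> 'b) \<Rightarrow> ('a \<times> 'b) set" where
  "K_epi K F = {(x, y). y - F x \<in> K}"

definition K_convex :: "'b::real_vector set \<Rightarrow> ('a::real_vector \<Rightarrow> 'b) \<Rightarrow> bool" where
  "K_convex K F \<longleftrightarrow> convex (K_epi K F)"

definition K_closed ::
  "'b::real_normed_vector set \<Rightarrow> ('a::real_normed_vector \<Rightarrow> 'b) \<Rightarrow> bool" where
  "K_closed K F \<longleftrightarrow> closed (K_epi K F)"

definition gph :: "('a \<Rightarrow> 'b) \<Rightarrow> ('a \<times> 'b) set" where
  "gph F = {(x, y). y = F x}"

definition argmin_set :: "('a \<Rightarrow> real) \<Rightarrow> 'a set" where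
  "argmin_set f = {x. is_arg_min f (\<lambda>_. True) x}"

definition affine_fun :: "('a::real_vector \<Rightarrow> real) \<Rightarrow> bool" where
  "affine_fun \<phi> \<longleftrightarrow> (\<exists>l c. linear l \<and> \<phi> = (\<lambda>x. l x + c))"

definition has_affine_majorant_on :: "('a::real_vector \<Rightarrow> real) \<Rightarrow> 'a set \<Rightarrow> bool" where
  "has_affine_majorant_on f C \<longleftrightarrow> (\<exists>\<phi>. affine_fun \<phi> \<and> (\<forall>x\<in>C. f x \<le> \<phi> x))"

text \<open>Finite dimension is stated explicitly on top of \<open>real_inner\<close>, since the class
  \<open>euclidean_space\<close> excludes the zero space.\<close>

definition finite_dim :: "'a::real_vector itself \<Rightarrow> bool" where
  "finite_dim _ \<longleftrightarrow> (\<exists>B :: 'a set. finite B \<and> span B = UNIV)"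

end

theory Submission
  imports Defs
begin

text \<open>
  Part (a) is two facts about the cone \<open>K\<close> and the map \<open>F\<close>. Jensen's inequality, applied to each
  \<open>f i\<close>, says that \<open>F\<close> of a convex combination lies below the convex combination of the values, up
  to a nonnegative combination of the \<open>b i\<close>, that is, up to an element of \<open>K\<close>; hence the epigraph is
  convex. It is closed because it is the preimage of \<open>K\<close> under \<open>(x, y) \<mapsto> y - F x\<close>: a finitely
  generated cone is closed, and \<open>F\<close> is continuous since convex functions on a finite-dimensional
  space are.

  Part (b) holds because a bilinear form that is nonnegative on pairs of generators is nonnegative
  on pairs of elements of the cone.

  In part (c), the epigraph is a closed convex set that contains the graph, so only one inclusion
  needs an argument. If \<open>(x, y)\<close> were an epigraph point outside the closed convex hull, a hyperplane
  with normal \<open>(u, v)\<close> would separate the two, so that \<open>u \<bullet> z + (\<Sum>i. f i z * (v \<bullet> b i))\<close> is bounded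
  above over all \<open>z\<close>. On \<open>C i\<close> every \<open>f j\<close> with \<open>j \<noteq> i\<close> is constant, so \<open>v \<bullet> b i > 0\<close> would turn
  this bound into an affine majorant of \<open>f i\<close> on \<open>C i\<close>. Therefore \<open>v \<bullet> b i \<le> 0\<close> for all \<open>i\<close>, so
  \<open>v\<close> lies in the polar cone of \<open>K\<close>. But then moving from the graph point \<open>(x, F x)\<close> to \<open>(x, y)\<close>, in
  a direction of \<open>K\<close>, cannot cross the hyperplane.

  The spaces are inner product spaces with a finite spanning set, not members of the class
  \<open>euclidean_space\<close>, so continuity of convex functions and separation of a point from a closed convex
  set are derived from a finite family \<open>B\<close> that satisfies \<open>x = (\<Sum>b\<in>B. (x \<bullet> b) *\<^sub>R b)\<close>.
\<close>

section \<open>Finite-dimensional inner product spaces\<close>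

text \<open>The zero vector may be a member of \<open>B\<close>; this makes \<open>B\<close> nonempty even in the zero space, so that
  averages over \<open>B\<close> make sense.\<close>

lemma finite_dim_obtain_frame:
  assumes "finite_dim TYPE('a::real_inner)"
  obtains B :: "'a::real_inner set" where "finite B" "B \<noteq> {}" "\<And>x. x = (\<Sum>b\<in>B. (x \<bullet> b) *\<^sub>R b)"
proof -
  obtain A :: "'a set" where "finite A" "span A = UNIV"
    using assms by (auto simp: finite_dim_def)
  then obtain D :: "'a set" where D: "finite D" "span D = UNIV" "pairwise orthogonal D"
    using basis_orthogonal[of A] by metis
  define N :: "'a set" where "N = (\<lambda>d. d /\<^sub>R norm d) ` (D - {0})"
  define B where "B = insert 0 N"
  have finN: "finite N" using D by (simp add: N_def)
  have unit: "d \<bullet> d = 1" if "d \<in> N" for d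
    using that by (auto simp: N_def dot_square_norm power_mult_distrib field_simps split: if_splits)
  have orth: "d \<bullet> e = 0" if de: "d \<in> N" "e \<in> N" "d \<noteq> e" for d e
  proof -
    obtain d' e' where 1: "d' \<in> D" "e' \<in> D" "d = d' /\<^sub>R norm d'" "e = e' /\<^sub>R norm e'"
      using de by (auto simp: N_def)
    with \<open>d \<noteq> e\<close> have "d' \<noteq> e'" by auto
    then have "d' \<bullet> e' = 0"
      using D(3) 1 by (auto simp: pairwise_def orthogonal_def)
    then show ?thesis using 1 by simp
  qed
  have "D \<subseteq> span N"
  proof
    fix d assume d: "d \<in> D"
    show "d \<in> span N"
    proof (cases "d = 0")
      case True then show ?thesis by (simp add: span_zero)
    next
      case False
      then have "d /\<^sub>R norm d \<in> span N" using d by (auto simp: N_def intro: span_base)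
      then have "norm d *\<^sub>R (d /\<^sub>R norm d) \<in> span N" by (rule span_mul)
      then show ?thesis using False by simp
    qed
  qed
  then have spanN: "span N = UNIV"
    using D(2) span_minimal[OF _ subspace_span] by blast
  have expand: "x = (\<Sum>b\<in>B. (x \<bullet> b) *\<^sub>R b)" for x
  proof -
    have "x \<in> span N" using spanN by simp
    then have "x = (\<Sum>b\<in>N. (x \<bullet> b) *\<^sub>R b)"
    proof (induction rule: span_induct_alt)
      case base then show ?case by simp
    next
      case (step c d y)
      have "(\<Sum>b\<in>N. (d \<bullet> b) *\<^sub>R b) = (\<Sum>b\<in>N. if b = d then d else 0)"
        using step(1) by (intro sum.cong) (auto simp: unit orth)
      also have "\<dots> = d" using finN step(1) by simp
      finally have "(\<Sum>b\<in>N. ((c *\<^sub>R d + y) \<bullet> b) *\<^sub>R b) = c *\<^sub>R d + (\<Sum>b\<in>N. (y \<bullet> b) *\<^sub>R b)"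
        by (simp add: inner_add_left scaleR_add_left sum.distrib flip: scaleR_scaleR
            scaleR_sum_right)
      then show ?case using step(2) by simp
    qed
    also have "\<dots> = (\<Sum>b\<in>B. (x \<bullet> b) *\<^sub>R b)"
      unfolding B_def by (rule sum.mono_neutral_left) (use finN in auto)
    finally show ?thesis .
  qed
  show ?thesis
    using that[of B] finN expand by (auto simp: B_def)
qed

lemma compact_coefficient_box:
  fixes B :: "'a::real_normed_vector set" and r :: "'a \<Rightarrow> real"
  assumes "finite B"
  shows "compact {\<Sum>b\<in>B. c b *\<^sub>R b |c. \<forall>b\<in>B. \<bar>c b\<bar> \<le> r b}"
  using assms
proof (induction B)
  case empty
  then show ?case by simp
next
  case (insert d B)
  let ?S = "{\<Sum>b\<in>B. c b *\<^sub>R b |c. \<forall>b\<in>B. \<bar>c b\<bar> \<le> r b}"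
  have "{\<Sum>b\<in>insert d B. c b *\<^sub>R b |c. \<forall>b\<in>insert d B. \<bar>c b\<bar> \<le> r b}
      = (\<lambda>(t, s). t *\<^sub>R d + s) ` ({- r d..r d} \<times> ?S)" (is "?L = ?R")
  proof
    show "?L \<subseteq> ?R" using insert.hyps by (force simp: abs_le_iff)
    show "?R \<subseteq> ?L"
    proof
      fix y assume "y \<in> ?R"
      then obtain t c where y: "y = t *\<^sub>R d + (\<Sum>b\<in>B. c b *\<^sub>R b)"
        and t: "\<bar>t\<bar> \<le> r d" and c: "\<forall>b\<in>B. \<bar>c b\<bar> \<le> r b" by (auto simp: abs_le_iff)
      have "(\<Sum>b\<in>B. (c(d := t)) b *\<^sub>R b) = (\<Sum>b\<in>B. c b *\<^sub>R b)"
        using insert.hyps by (intro sum.cong) auto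
      then have "y = (\<Sum>b\<in>insert d B. (c(d := t)) b *\<^sub>R b)"
        using insert.hyps y by simp
      moreover have "\<forall>b\<in>insert d B. \<bar>(c(d := t)) b\<bar> \<le> r b" using t c by auto
      ultimately show "y \<in> ?L" by blast
    qed
  qed
  moreover have "compact \<dots>"
    unfolding case_prod_beta
    by (intro compact_continuous_image continuous_intros compact_Times insert.IH) auto
  ultimately show ?case by simp
qed

lemma finite_dim_compact_cball:
  assumes "finite_dim TYPE('a::real_inner)"
  shows "compact (cball (a::'a::real_inner) R)"
proof -
  obtain B :: "'a set" where B: "finite B" "\<And>x. x = (\<Sum>b\<in>B. (x \<bullet> b) *\<^sub>R b)"
    using finite_dim_obtain_frame[OF assms] by metis
  define S where "S = {\<Sum>b\<in>B. c b *\<^sub>R b |c. \<forall>b\<in>B. \<bar>c b\<bar> \<le> (norm a + R) * norm b}"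
  have "x \<in> S" if "x \<in> cball a R" for x
  proof -
    have "norm x \<le> norm a + R"
      using that norm_triangle_ineq4[of a "a - x"] by (simp add: dist_norm)
    then have "\<bar>x \<bullet> b\<bar> \<le> (norm a + R) * norm b" for b
      using Cauchy_Schwarz_ineq2[of x b] mult_right_mono[of "norm x" "norm a + R" "norm b"]
      by auto
    then show ?thesis using B(2)[of x] unfolding S_def by blast
  qed
  then have "cball a R = S \<inter> cball a R" by blast
  moreover have "compact (S \<inter> cball a R)"
    unfolding S_def by (intro compact_Int_closed compact_coefficient_box B closed_cball)
  ultimately show ?thesis by simp
qed

lemma finite_dim_Times:
  assumes "finite_dim TYPE('a::real_inner)" "finite_dim TYPE('b::real_inner)"
  shows "finite_dim TYPE('a::real_inner \<times> 'b::real_inner)"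
proof -
  obtain A :: "'a set" where A: "finite A" "span A = UNIV"
    using assms by (auto simp: finite_dim_def)
  obtain B :: "'b set" where B: "finite B" "span B = UNIV"
    using assms by (auto simp: finite_dim_def)
  let ?S = "(\<lambda>a. (a, 0)) ` A \<union> (\<lambda>b. (0, b)) ` B"
  have "(x, y) \<in> span ?S" for x :: 'a and y :: 'b
  proof -
    have "linear (\<lambda>a::'a. (a, 0::'b))" "linear (\<lambda>b::'b. (0::'a, b))"
      by (auto intro!: linearI)
    then have "(x, 0) \<in> span ((\<lambda>a. (a, 0::'b)) ` A)" "(0, y) \<in> span ((\<lambda>b. (0::'a, b)) ` B)"
      using A(2) B(2) by (simp_all add: linear_span_image)
    then have "(x, 0) + (0, y) \<in> span ?S"
      by (intro span_add) (meson span_mono subsetD Un_upper1 Un_upper2)+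
    then show ?thesis by simp
  qed
  then show ?thesis
    using A(1) B(1) unfolding finite_dim_def by (intro exI[of _ ?S]) auto
qed

text \<open>The normal is \<open>a - p\<close>, where \<open>p\<close> is a point of \<open>S\<close> nearest to \<open>a\<close>. Compactness of balls
  provides \<open>p\<close>.\<close>

lemma finite_dim_separating_normal:
  fixes S :: "'a::real_inner set"
  assumes fd: "finite_dim TYPE('a)" and S: "convex S" "closed S" and a: "a \<notin> S"
  obtains w c where "\<And>z. z \<in> S \<Longrightarrow> w \<bullet> z \<le> c" "c < w \<bullet> a"
proof (cases "S = {}")
  case True
  then show ?thesis using that[of 0 "-1"] by simp
next
  case False
  then obtain s where s: "s \<in> S" by blast
  let ?T = "S \<inter> cball a (dist a s)"
  have "compact ?T" using finite_dim_compact_cball[OF fd] S(2) by (simp add: closed_Int_compact)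
  moreover have "?T \<noteq> {}" using s by auto
  ultimately obtain p where p: "p \<in> ?T" "\<And>z. z \<in> ?T \<Longrightarrow> dist a p \<le> dist a z"
    using continuous_attains_inf[of ?T "dist a"] continuous_on_dist[OF continuous_on_const continuous_on_id]
    by blast
  have near: "\<forall>z\<in>S. dist a p \<le> dist a z"
    using p by (metis IntI IntD2 linorder_linear mem_cball order_trans)
  have "(a - p) \<bullet> z \<le> (a - p) \<bullet> p" if "z \<in> S" for z
    using any_closest_point_dot[OF S _ that near] p(1) by (simp add: inner_diff_right)
  moreover have "(a - p) \<bullet> p < (a - p) \<bullet> a"
  proof -
    have "a - p \<noteq> 0" using a p(1) by auto
    then have "0 < (a - p) \<bullet> (a - p)" by (metis inner_gt_zero_iff)
    then show ?thesis by (simp add: inner_diff_right)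
  qed
  ultimately show ?thesis using that by blast
qed

text \<open>Near \<open>x0\<close>, a point is the average of points \<open>x0 + s *\<^sub>R b\<close> on the finitely many axes through \<open>x0\<close>,
  with \<open>s\<close> in a fixed bounded interval; on each such segment \<open>f\<close> is at most the larger endpoint value.
  So \<open>f\<close> is locally bounded above, which for a convex function implies continuity.\<close>

lemma finite_dim_convex_on_continuous:
  fixes f :: "'a::real_inner \<Rightarrow> real"
  assumes fd: "finite_dim TYPE('a)" and f: "convex_on UNIV f"
  shows "continuous_on UNIV f"
proof -
  obtain B :: "'a set" where B: "finite B" "B \<noteq> {}" "\<And>x. x = (\<Sum>b\<in>B. (x \<bullet> b) *\<^sub>R b)"
    using finite_dim_obtain_frame[OF fd] by metis
  define N where "N = real (card B)"
  have N: "N > 0" using B by (simp add: N_def card_gt_0_iff)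
  have "isCont f x0" for x0
  proof -
    \<comment> \<open>Averaging over \<open>B\<close> divides coefficients by \<open>N\<close>, so the axes must be \<open>N\<close> times as long as
      the coefficients \<open>(x - x0) \<bullet> b\<close>, which are at most \<open>norm b\<close> on the unit ball around \<open>x0\<close>.\<close>
    define T where "T b = N * norm b" for b :: 'a
    define m where "m b = max (f (x0 + T b *\<^sub>R b)) (f (x0 - T b *\<^sub>R b))" for b
    define M where "M = (\<Sum>b\<in>B. 1 / N * m b)"
    have seg: "f (x0 + s *\<^sub>R b) \<le> m b" if "\<bar>s\<bar> \<le> T b" for s b
    proof -
      let ?p = "x0 + T b *\<^sub>R b" and ?q = "x0 - T b *\<^sub>R b"
      have "x0 + s *\<^sub>R b \<in> closed_segment ?q ?p"
      proof (cases "T b = 0")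
        case True then show ?thesis using that by simp
      next
        case False
        define u where "u = (s + T b) / (2 * T b)"
        have "0 < T b" using False that by linarith
        then have "0 \<le> u" "u \<le> 1" using that by (auto simp: u_def field_simps)
        have "s = (1 - u) * - T b + u * T b"
          using False by (simp add: u_def field_simps)
        then have "x0 + s *\<^sub>R b = (1 - u) *\<^sub>R ?q + u *\<^sub>R ?p"
          by (simp add: algebra_simps flip: scaleR_add_left)
        then show ?thesis using \<open>0 \<le> u\<close> \<open>u \<le> 1\<close> by (auto simp: in_segment)
      qed
      then have "x0 + s *\<^sub>R b \<in> convex hull {?q, ?p}" by (simp add: segment_convex_hull)
      moreover have "\<forall>x\<in>{?q, ?p}. f x \<le> m b" by (auto simp: m_def)
      ultimately show ?thesis
        using convex_on_convex_hull_bound[of "{?q, ?p}" f "m b"] convex_on_subset[OF f]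
        by (meson convex_convex_hull subset_UNIV)
    qed
    have up: "f x \<le> M" if "x \<in> cball x0 1" for x
    proof -
      have h: "norm (x - x0) \<le> 1" using that by (simp add: dist_norm norm_minus_commute)
      let ?y = "\<lambda>b. x0 + (N * ((x - x0) \<bullet> b)) *\<^sub>R b"
      have sum1: "(\<Sum>b\<in>B. 1 / N) = 1" using N by (simp add: N_def)
      have "(\<Sum>b\<in>B. (1 / N) *\<^sub>R ?y b)
          = (\<Sum>b\<in>B. 1 / N) *\<^sub>R x0 + (\<Sum>b\<in>B. ((x - x0) \<bullet> b) *\<^sub>R b)"
        using N by (simp add: scaleR_add_right sum.distrib flip: scaleR_sum_left)
      also have "\<dots> = x" using sum1 B(3)[of "x - x0"] by simp
      finally have "f x = f (\<Sum>b\<in>B. (1 / N) *\<^sub>R ?y b)" by simp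
      also have "\<dots> \<le> (\<Sum>b\<in>B. 1 / N * f (?y b))"
        by (rule convex_on_sum[OF B(1,2) f sum1]) (use N in auto)
      also have "\<dots> \<le> M"
        unfolding M_def
      proof (intro sum_mono mult_left_mono seg)
        fix b
        have "\<bar>(x - x0) \<bullet> b\<bar> \<le> norm b"
          using Cauchy_Schwarz_ineq2[of "x - x0" b] mult_right_mono[OF h, of "norm b"] by simp
        then show "\<bar>N * ((x - x0) \<bullet> b)\<bar> \<le> T b" using N by (simp add: T_def abs_mult)
      qed (use N in auto)
      finally show ?thesis .
    qed
    have "\<forall>y\<in>cball x0 1. \<bar>f y\<bar> \<le> M + 2 * \<bar>f x0\<bar>"
      using convex_bounds_lemma[OF convex_on_subset[OF f] up] by auto
    then have "continuous_on (ball x0 1) f"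
      by (intro convex_on_bounded_continuous convex_on_subset[OF f]) auto
    then show ?thesis by (simp add: continuous_on_eq_continuous_at)
  qed
  then show ?thesis by (simp add: continuous_at_imp_continuous_on)
qed

section \<open>Finitely generated cones\<close>

lemma convex_cone_hull_insert_eq:
  "convex_cone hull (insert b S) = {k + t *\<^sub>R b |k t. k \<in> convex_cone hull S \<and> 0 \<le> t}" (is "?L = ?R")
proof
  show "?L \<subseteq> ?R"
  proof (rule hull_minimal)
    have "b \<in> ?R" using convex_cone_hull_contains_0[of S] by (force intro: exI[of _ 1])
    moreover have "S \<subseteq> ?R" by (force intro: hull_inc exI[of _ 0])
    ultimately show "insert b S \<subseteq> ?R" by blast
    show "convex_cone ?R"
    proof (rule convex_cone_iff[THEN iffD2], intro conjI ballI allI impI)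
      show "0 \<in> ?R" using convex_cone_hull_contains_0[of S] by (force intro: exI[of _ 0])
    next
      fix x y assume "x \<in> ?R" "y \<in> ?R"
      then obtain k t l s where *: "x = k + t *\<^sub>R b" "y = l + s *\<^sub>R b" "0 \<le> t" "0 \<le> s"
        "k \<in> convex_cone hull S" "l \<in> convex_cone hull S" by blast
      then have "x + y = (k + l) + (t + s) *\<^sub>R b" by (simp add: algebra_simps)
      then show "x + y \<in> ?R" using * convex_cone_hull_add by fastforce
    next
      fix x and c :: real assume "x \<in> ?R" "0 \<le> c"
      then obtain k t where *: "x = k + t *\<^sub>R b" "0 \<le> t" "k \<in> convex_cone hull S" by blast
      then have "c *\<^sub>R x = c *\<^sub>R k + (c * t) *\<^sub>R b" by (simp add: algebra_simps)
      then show "c *\<^sub>R x \<in> ?R" using * \<open>0 \<le> c\<close> convex_cone_hull_mul by fastforce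
    qed
  qed
  show "?R \<subseteq> ?L"
  proof clarify
    fix k and t :: real assume "k \<in> convex_cone hull S" "0 \<le> t"
    moreover have "convex_cone hull S \<subseteq> ?L" by (rule hull_mono) blast
    ultimately show "k + t *\<^sub>R b \<in> ?L"
      by (intro convex_cone_hull_add convex_cone_hull_mul) (auto intro: hull_inc)
  qed
qed

text \<open>Some ball of radius \<open>e\<close> around \<open>- b\<close> misses \<open>K\<close>, which by scaling gives
  \<open>e * t \<le> norm (k + t *\<^sub>R b)\<close>. Along a convergent sequence the coefficients \<open>t\<close> therefore stay in a
  compact interval.\<close>

lemma closed_cone_plus_ray:
  fixes K :: "'a::real_normed_vector set"
  assumes "closed K" "conic K" "- b \<notin> K"
  shows "closed {k + t *\<^sub>R b |k t. k \<in> K \<and> 0 \<le> t}" (is "closed ?R")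
proof -
  obtain e where e: "e > 0" "ball (- b) e \<subseteq> - K"
    using assms by (meson ComplI open_Compl open_contains_ball)
  have bound: "e * t \<le> norm (k + t *\<^sub>R b)" if "k \<in> K" "0 \<le> t" for k t
  proof (cases "t = 0")
    case True then show ?thesis by simp
  next
    case False
    with that have t: "t > 0" by simp
    have "(1 / t) *\<^sub>R k \<in> K" using assms(2) that t by (simp add: conic_def)
    then have "e \<le> dist (- b) ((1 / t) *\<^sub>R k)" using e(2) by force
    also have "\<dots> = norm (b + (1 / t) *\<^sub>R k)"
      by (metis dist_norm minus_add_distrib norm_minus_cancel uminus_add_conv_diff
          diff_conv_add_uminus)
    finally have "t * e \<le> t * norm (b + (1 / t) *\<^sub>R k)"
      using t by simp
    also have "\<dots> = norm (t *\<^sub>R (b + (1 / t) *\<^sub>R k))" using t by simp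
    also have "t *\<^sub>R (b + (1 / t) *\<^sub>R k) = k + t *\<^sub>R b" using t by (simp add: algebra_simps)
    finally show ?thesis by (simp add: mult.commute)
  qed
  show ?thesis
    unfolding closed_sequential_limits
  proof clarify
    fix y l assume y: "\<forall>n. y n \<in> ?R" and lim: "y \<longlonglongrightarrow> l"
    obtain R where R: "\<And>n. norm (y n) \<le> R"
      using convergent_imp_Bseq[of y] lim by (meson BseqE convergentI)
    let ?T = "\<Union>k\<in>K. \<Union>s\<in>(\<lambda>t. t *\<^sub>R b) ` {0..R / e}. {k + s}"
    have "y n \<in> ?T" for n
    proof -
      obtain k t where kt: "y n = k + t *\<^sub>R b" "k \<in> K" "0 \<le> t" using y by blast
      then have "e * t \<le> R" using bound[of k t] R[of n] by simp
      then have "t \<le> R / e" using e(1) by (simp add: field_simps)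
      then have "t \<in> {0..R / e}" using kt(3) by simp
      then show ?thesis using kt(1,2) by blast
    qed
    moreover have "closed ?T"
      by (intro closed_compact_sums assms compact_continuous_image continuous_intros)
        (rule compact_Icc)
    ultimately have "l \<in> ?T" using lim closed_sequentially by blast
    then obtain k t where "l = k + t *\<^sub>R b" "k \<in> K" "0 \<le> t" by auto
    then show "\<exists>k t. l = k + t *\<^sub>R b \<and> k \<in> K \<and> 0 \<le> t" by blast
  qed
qed

text \<open>A generator \<open>b\<close> is added to the cone \<open>K\<close> of the others. If \<open>- b \<notin> K\<close>, the previous lemma
  applies. Otherwise the new cone contains the line through \<open>b\<close>, so it is the preimage of its
  projection along that line, and the projection is a cone with fewer generators.\<close>

lemma closed_finitely_generated_cone:
  fixes S :: "'a::real_inner set"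
  assumes "finite S"
  shows "closed (convex_cone hull S)"
  using assms
proof (induction "card S" arbitrary: S rule: less_induct)
  case less
  show ?case
  proof (cases "S = {}")
    case True then show ?thesis by simp
  next
    case False
    then obtain b where b: "b \<in> S" by blast
    define S' where "S' = S - {b}"
    have S: "S = insert b S'" using b by (auto simp: S'_def)
    have S': "finite S'" "card S' < card S"
      using less.prems b by (auto simp: S'_def card_Diff1_less simp del: card_Diff_insert)
    define L where "L = convex_cone hull S'"
    have L: "closed L" unfolding L_def using less.hyps S' by blast
    have hull: "convex_cone hull S = {k + t *\<^sub>R b |k t. k \<in> L \<and> 0 \<le> t}"
      unfolding S L_def by (rule convex_cone_hull_insert_eq)
    show ?thesis
    proof (cases "- b \<in> L")
      case False
      then show ?thesis
        unfolding hull using L conic_convex_cone_hull unfolding L_def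
        by (intro closed_cone_plus_ray) auto
    next
      case True
      define P where "P y = y - (y \<bullet> b / (b \<bullet> b)) *\<^sub>R b" for y
      have P: "linear P"
        unfolding P_def
        by (rule linearI) (simp_all add: inner_add_left add_divide_distrib algebra_simps)
      have Pb: "P b = 0" by (cases "b = 0") (simp_all add: P_def)
      let ?Q = "convex_cone hull (P ` S')"
      have Q: "?Q = P ` L"
        unfolding L_def using convex_cone_hull_linear_image[OF P] .
      have "card (P ` S') < card S" using S' card_image_le[of S' P] by linarith
      then have "closed ?Q" using less.hyps S'(1) by blast
      moreover have "continuous_on UNIV P"
        unfolding P_def divide_inverse by (intro continuous_intros)
      ultimately have "closed (P -` ?Q)" by (simp add: closed_vimage)
      moreover have "convex_cone hull S = P -` ?Q"
      proof
        show "convex_cone hull S \<subseteq> P -` ?Q"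
          unfolding hull Q by (auto simp: linear_add[OF P] linear_scale[OF P] Pb)
        show "P -` ?Q \<subseteq> convex_cone hull S"
        proof
          fix y assume "y \<in> P -` ?Q"
          then obtain k where k: "k \<in> L" "P y = P k" by (auto simp: Q)
          define s where "s = y \<bullet> b / (b \<bullet> b) - k \<bullet> b / (b \<bullet> b)"
          have y: "y = k + s *\<^sub>R b" using k(2) by (simp add: P_def s_def algebra_simps)
          show "y \<in> convex_cone hull S"
          proof (cases "0 \<le> s")
            case True then show ?thesis unfolding hull using y k(1) by blast
          next
            case False
            then have "(- s) *\<^sub>R (- b) \<in> L"
              unfolding L_def
              by (intro convex_cone_hull_mul) (use \<open>- b \<in> L\<close> in \<open>simp_all add: L_def\<close>)
            then have "y \<in> L"
              unfolding y using k(1) convex_cone_hull_add unfolding L_def by fastforce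
            then have "y = y + 0 *\<^sub>R b \<and> y \<in> L \<and> (0::real) \<le> 0" by simp
            then show ?thesis unfolding hull by blast
          qed
        qed
      qed
      ultimately show ?thesis by simp
    qed
  qed
qed

lemma inner_nonneg_convex_cone_hull_iff:
  fixes S :: "'a::real_inner set"
  shows "(\<forall>u\<in>convex_cone hull S. \<forall>v\<in>convex_cone hull S. 0 \<le> u \<bullet> v) \<longleftrightarrow> (\<forall>u\<in>S. \<forall>v\<in>S. 0 \<le> u \<bullet> v)"
proof
  assume "\<forall>u\<in>convex_cone hull S. \<forall>v\<in>convex_cone hull S. 0 \<le> u \<bullet> v"
  then show "\<forall>u\<in>S. \<forall>v\<in>S. 0 \<le> u \<bullet> v" by (meson hull_inc)
next
  assume S: "\<forall>u\<in>S. \<forall>v\<in>S. 0 \<le> u \<bullet> v"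
  have 1: "convex_cone hull S \<subseteq> {v. u \<bullet> v \<ge> 0}" if "u \<in> S" for u
    by (rule hull_minimal) (use S that convex_cone_halfspace_ge in auto)
  have "convex_cone hull S \<subseteq> {u. v \<bullet> u \<ge> 0}" if "v \<in> convex_cone hull S" for v
  proof (rule hull_minimal)
    show "S \<subseteq> {u. v \<bullet> u \<ge> 0}" using 1 that by (force simp: inner_commute)
  qed (rule convex_cone_halfspace_ge)
  then show "\<forall>u\<in>convex_cone hull S. \<forall>v\<in>convex_cone hull S. 0 \<le> u \<bullet> v" by auto
qed

lemma subset_uminus_polar_cone_iff:
  "K \<subseteq> uminus ` polar_cone K \<longleftrightarrow> (\<forall>u\<in>K. \<forall>v\<in>K. 0 \<le> u \<bullet> v)"
proof -
  have "v \<in> uminus ` polar_cone K \<longleftrightarrow> - v \<in> polar_cone K" for v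
    by (metis imageE imageI minus_minus)
  then show ?thesis by (auto simp: polar_cone_def subset_iff)
qed

section \<open>The epigraph with respect to a cone\<close>

lemma K_closed_if_continuous:
  fixes F :: "'a::real_normed_vector \<Rightarrow> 'b::real_normed_vector"
  assumes "closed K" "continuous_on UNIV F"
  shows "K_closed K F"
proof -
  have "K_epi K F = (\<lambda>p. snd p - F (fst p)) -` K" by (auto simp: K_epi_def)
  moreover have "continuous_on UNIV (\<lambda>p::'a \<times> 'b. snd p - F (fst p))"
    by (intro continuous_intros continuous_on_compose2[OF assms(2)]) auto
  ultimately show ?thesis
    unfolding K_closed_def using assms(1) by (simp add: closed_vimage)
qed

lemma K_convex_sum_scaleR:
  fixes f :: "'i \<Rightarrow> 'a::real_vector \<Rightarrow> real" and b :: "'i \<Rightarrow> 'b::real_vector"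
  assumes K: "convex_cone K" and b: "\<And>i. i \<in> I \<Longrightarrow> b i \<in> K"
    and f: "\<And>i. i \<in> I \<Longrightarrow> convex_on UNIV (f i)"
  shows "K_convex K (\<lambda>x. \<Sum>i\<in>I. f i x *\<^sub>R b i)"
proof -
  define F where "F x = (\<Sum>i\<in>I. f i x *\<^sub>R b i)" for x
  have combination: "(\<Sum>i\<in>I. c i *\<^sub>R b i) \<in> K" if "\<And>i. i \<in> I \<Longrightarrow> 0 \<le> c i" for c :: "'i \<Rightarrow> real"
    using that b
    by (induction I rule: infinite_finite_induct)
      (auto simp: convex_cone_contains_0 K convex_cone_add convex_cone_scaleR)
  have gap: "u *\<^sub>R F x + v *\<^sub>R F x' - F (u *\<^sub>R x + v *\<^sub>R x') \<in> K"
    if "0 \<le> u" "0 \<le> v" "u + v = 1" for u v x x'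
  proof -
    have "0 \<le> u * f i x + v * f i x' - f i (u *\<^sub>R x + v *\<^sub>R x')" if "i \<in> I" for i
      using f[OF that] \<open>0 \<le> u\<close> \<open>0 \<le> v\<close> \<open>u + v = 1\<close> by (simp add: convex_on_def)
    then have "(\<Sum>i\<in>I. (u * f i x + v * f i x' - f i (u *\<^sub>R x + v *\<^sub>R x')) *\<^sub>R b i) \<in> K"
      by (rule combination)
    then show ?thesis
      by (simp add: F_def scaleR_sum_right algebra_simps sum.distrib sum_subtractf)
  qed
  have "convex (K_epi K F)"
    unfolding convex_def
  proof (intro ballI allI impI)
    fix p q :: "'a \<times> 'b" and u v :: real
    assume pq: "p \<in> K_epi K F" "q \<in> K_epi K F" and uv: "0 \<le> u" "0 \<le> v" "u + v = 1"
    obtain x y x' y' where [simp]: "p = (x, y)" "q = (x', y')" by fastforce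
    have "u *\<^sub>R (y - F x) + v *\<^sub>R (y' - F x')
        + (u *\<^sub>R F x + v *\<^sub>R F x' - F (u *\<^sub>R x + v *\<^sub>R x')) \<in> K"
      using pq uv gap[OF uv] K
      by (intro convex_cone_add convex_cone_scaleR) (auto simp: K_epi_def)
    then show "u *\<^sub>R p + v *\<^sub>R q \<in> K_epi K F"
      by (simp add: K_epi_def algebra_simps)
  qed
  then show ?thesis by (simp add: K_convex_def F_def[abs_def])
qed

text \<open>Minimizers of \<open>f j\<close> share one value of \<open>f j\<close>, so on the common minimizers of the \<open>f j\<close> with
  \<open>j \<noteq> i\<close> the given bound involves \<open>f i\<close>, a linear functional, and constants only; dividing by the
  positive coefficient of \<open>f i\<close> leaves an affine bound.\<close>

lemma affine_majorant_on_common_argmin: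
  fixes f :: "'i \<Rightarrow> 'a::real_inner \<Rightarrow> real"
  assumes I: "finite I" "i \<in> I" and pos: "0 < a i"
    and bound: "\<And>z. u \<bullet> z + (\<Sum>j\<in>I. f j z * a j) \<le> c"
  shows "has_affine_majorant_on (f i) (\<Inter>j\<in>I - {i}. argmin_set (f j))"
proof (cases "(\<Inter>j\<in>I - {i}. argmin_set (f j)) = {}")
  case True
  have "affine_fun (\<lambda>x::'a. 0 + (0::real))"
    unfolding affine_fun_def by (intro exI[of _ "\<lambda>_. 0"] exI[of _ 0]) (simp add: linear_zero)
  then show ?thesis unfolding True has_affine_majorant_on_def by blast
next
  case False
  then obtain x0 where x0: "x0 \<in> (\<Inter>j\<in>I - {i}. argmin_set (f j))" by blast
  define d where "d = (\<Sum>j\<in>I - {i}. f j x0 * a j)"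
  define l where "l z = - (u \<bullet> z) / a i" for z
  have "linear l"
    unfolding l_def by (rule linearI) (simp_all add: inner_add_right diff_divide_distrib)
  then have "affine_fun (\<lambda>z. l z + (c - d) / a i)" unfolding affine_fun_def by blast
  moreover have "f i z \<le> l z + (c - d) / a i"
    if z: "z \<in> (\<Inter>j\<in>I - {i}. argmin_set (f j))" for z
  proof -
    have "f j z = f j x0" if "j \<in> I - {i}" for j
      using z x0 that by (force simp: argmin_set_def is_arg_min_def not_less intro: antisym)
    then have "(\<Sum>j\<in>I - {i}. f j z * a j) = d" by (simp add: d_def)
    then have "u \<bullet> z + f i z * a i + d \<le> c"
      using bound[of z] sum.remove[OF I, of "\<lambda>j. f j z * a j"] by simp
    then have "f i z \<le> (c - d - u \<bullet> z) / a i"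
      using pos by (simp add: pos_le_divide_eq)
    then show ?thesis by (simp add: l_def diff_divide_distrib)
  qed
  ultimately show ?thesis unfolding has_affine_majorant_on_def by blast
qed

text \<open>Every half-space that contains the graph has its outer normal's second component \<open>v\<close> in the polar
  cone of \<open>K\<close>, because an index \<open>i\<close> with \<open>v \<bullet> b i > 0\<close> produces an affine majorant. Such a half-space
  contains the whole epigraph, so no hyperplane can cut off an epigraph point.\<close>

lemma K_epi_subset_closure_convex_hull_gph:
  fixes f :: "'i \<Rightarrow> 'a::real_inner \<Rightarrow> real" and b :: "'i \<Rightarrow> 'b::real_inner"
  assumes fd: "finite_dim TYPE('a)" "finite_dim TYPE('b)" and I: "finite I"
    and no_majorant:
      "\<And>i. i \<in> I \<Longrightarrow> \<not> has_affine_majorant_on (f i) (\<Inter>j\<in>I - {i}. argmin_set (f j))"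
    and F: "\<And>x. F x = (\<Sum>i\<in>I. f i x *\<^sub>R b i)"
  shows "K_epi (convex_cone hull (b ` I)) F \<subseteq> closure (convex hull (gph F))" (is "K_epi ?K F \<subseteq> ?H")
proof (rule ccontr)
  assume "\<not> K_epi ?K F \<subseteq> ?H"
  then obtain x y where y: "y - F x \<in> ?K" and out: "(x, y) \<notin> ?H"
    by (auto simp: K_epi_def)
  obtain w c where w: "\<And>p. p \<in> ?H \<Longrightarrow> w \<bullet> p \<le> c" "c < w \<bullet> (x, y)"
    using finite_dim_separating_normal[OF finite_dim_Times[OF fd] _ _ out]
    by (metis closed_closure convex_closure convex_convex_hull)
  obtain u v where w_eq: "w = (u, v)" by fastforce
  have on_graph: "u \<bullet> z + v \<bullet> F z \<le> c" for z
  proof -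
    have "(z, F z) \<in> convex hull gph F" by (intro hull_inc) (simp add: gph_def)
    then have "(z, F z) \<in> ?H" using closure_subset by blast
    then show ?thesis using w(1) w_eq by fastforce
  qed
  have bound: "u \<bullet> z + (\<Sum>j\<in>I. f j z * (v \<bullet> b j)) \<le> c" for z
    using on_graph[of z] by (simp add: F inner_sum_right)
  have "v \<bullet> b i \<le> 0" if "i \<in> I" for i
    using affine_majorant_on_common_argmin[OF I that _ bound] no_majorant[OF that]
    by (meson not_le)
  then have "?K \<subseteq> {k. v \<bullet> k \<le> 0}"
    by (intro hull_minimal convex_cone_halfspace_le) auto
  then have "v \<bullet> (y - F x) \<le> 0" using y by blast
  then show False
    using on_graph[of x] w(2) by (simp add: w_eq inner_diff_right)
qed

theorem proposition52:
  fixes n :: nat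
    and b :: "nat \<Rightarrow> 'b::real_inner"
    and f :: "nat \<Rightarrow> 'a::real_inner \<Rightarrow> real"
    and F :: "'a \<Rightarrow> 'b"
    and K :: "'b set"
    and C :: "nat \<Rightarrow> 'a set"
  assumes fin_dim1: "finite_dim TYPE('a)"
    and fin_dim2: "finite_dim TYPE('b)"
    and conv: "\<And>i. i \<in> {1..n} \<Longrightarrow> convex_on UNIV (f i)"
    and F: "\<And>x. F x = (\<Sum>i=1..n. f i x *\<^sub>R b i)"
    and K: "K = convex_cone hull (b ` {1..n})"
    and C: "\<And>i. i \<in> {1..n} \<Longrightarrow> C i = (\<Inter>j\<in>{1..n} - {i}. argmin_set (f j))"
  shows "(K_convex K F \<and> K_closed K F)
    \<and> (K \<subseteq> uminus ` polar_cone K \<longleftrightarrow> (\<forall>i\<in>{1..n}. \<forall>j\<in>{1..n}. b i \<bullet> b j \<ge> 0))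
    \<and> ((\<forall>i\<in>{1..n}. C i \<noteq> {} \<and> \<not> has_affine_majorant_on (f i) (C i))
          \<longrightarrow> K_epi K F = closure (convex hull (gph F)))"
proof (intro conjI impI)
  have F_eq: "F = (\<lambda>x. \<Sum>i=1..n. f i x *\<^sub>R b i)" using F by blast
  show convex: "K_convex K F"
    unfolding F_eq K
    by (intro K_convex_sum_scaleR convex_cone_convex_cone_hull conv) (auto intro: hull_inc)
  show closed: "K_closed K F"
  proof (rule K_closed_if_continuous)
    show "closed K" unfolding K by (intro closed_finitely_generated_cone) simp
    show "continuous_on UNIV F"
      unfolding F_eq
      by (intro continuous_intros finite_dim_convex_on_continuous fin_dim1 conv)
  qed
  show "K \<subseteq> uminus ` polar_cone K \<longleftrightarrow> (\<forall>i\<in>{1..n}. \<forall>j\<in>{1..n}. b i \<bullet> b j \<ge> 0)"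
    unfolding subset_uminus_polar_cone_iff K inner_nonneg_convex_cone_hull_iff by simp
  assume C_hyp: "\<forall>i\<in>{1..n}. C i \<noteq> {} \<and> \<not> has_affine_majorant_on (f i) (C i)"
  show "K_epi K F = closure (convex hull (gph F))"
  proof
    show "K_epi K F \<subseteq> closure (convex hull (gph F))"
      unfolding K using C_hyp C F
      by (intro K_epi_subset_closure_convex_hull_gph[OF fin_dim1 fin_dim2]) auto
    have "gph F \<subseteq> K_epi K F"
      by (auto simp: gph_def K_epi_def K convex_cone_hull_contains_0)
    then show "closure (convex hull (gph F)) \<subseteq> K_epi K F"
      using convex closed unfolding K_convex_def K_closed_def
      by (intro closure_minimal hull_minimal) auto
  qed
qed

end
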